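(* Let $s,k,t \in \mathbb{N}$ with $k \geq t \geq 2$ and let $r = s(k-t+1)+1$. There is an edge-colouring of the complete $k$-uniform hypergraph $\mathcal{K}_{\mathbb{N}}^{(k)}$ (vertex set $\mathbb{N}$, edge set $\binom{\mathbb{N}}{k}$) with $r$ colours such that there do not exist $s$ monochromatic $t$-tight Berge-paths (finite or infinite) whose cores together cover $\mathbb{N}$.
   Context: A $k$-graph is a pair $(V,\mathcal{E})$ with $\mathcal{E} \subseteq \binom{V}{k}$. For integers $2 \le t \le k$ and $\ell \ge 1$, a finite $t$-tight Berge-path of length $\ell$ in a $k$-graph is a pair $(X,F)$ where $X=\{v_1,\dots,v_{\ell+t-1}\}$ is a set of $\ell+t-1$ distinct vertices, $F=\{e_1,\dots,e_\ell\}$ is a set of $\ell$ distinct edges, and $v_i,v_{i+1},\dots,v_{i+t-1} \in e_i$ for all $i\in[\ell]$. A $t$-tight Berge-path of length $0$ is a pair $(\{v\},\emptyset)$. An infinite $t$-tight Berge-path is a pair $(X,F)$ with $X=\{v_i : i\in\mathbb{N}\}$ (distinct vertices), $F=\{e_i: i\in\mathbb{N}\}$ (distinct edges) and $v_i,\dots,v_{i+t-1}\in e_i$ for all $i$. $X$ is called the core of the path. Given an edge-colouring $\varphi$, a path $(X,F)$ is monochromatic (in colour $c$) if $\varphi(f)=c$ for all $f\in F$. *)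

theory Defs
  imports "HOL-Library.Ramsey"
begin

type_synonym 'a hypergraph = "'a set \<times> 'a set set"

definition complete_kgraph :: "'a set \<Rightarrow> nat \<Rightarrow> 'a hypergraph" where
  "complete_kgraph V k = (V, nsets V k)"

definition edge_colouring :: "'a hypergraph \<Rightarrow> nat \<Rightarrow> ('a set \<Rightarrow> nat) \<Rightarrow> bool" where
  "edge_colouring H r \<phi> \<longleftrightarrow> \<phi> \<in> snd H \<rightarrow> {..<r}"

text \<open>
  A Berge-path is a pair of its core \<open>X\<close> and its edge set \<open>F\<close>; the enumerations \<open>v\<close> and \<open>e\<close>
  are existentially quantified, \<open>v ` {i..i+t-1} \<subseteq> e i\<close> saying that
  \<open>v i, v (i+1), ..., v (i+t-1)\<close> all lie in \<open>e i\<close>.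
  Length 0 is separate: the general clause would give a core of \<open>t - 1\<close> vertices instead of one.
\<close>

definition finite_tight_berge_path ::
    "nat \<Rightarrow> 'a hypergraph \<Rightarrow> nat \<Rightarrow> 'a set \<times> 'a set set \<Rightarrow> bool" where
  "finite_tight_berge_path t H l P \<longleftrightarrow>
     (if l = 0 then \<exists>v \<in> fst H. P = ({v}, {})
      else \<exists>v e. inj_on v {1..l+t-1} \<and> v ` {1..l+t-1} \<subseteq> fst H \<and>
                 inj_on e {1..l} \<and> e ` {1..l} \<subseteq> snd H \<and>
                 (\<forall>i\<in>{1..l}. v ` {i..i+t-1} \<subseteq> e i) \<and>
                 P = (v ` {1..l+t-1}, e ` {1..l}))"

definition infinite_tight_berge_path ::
    "nat \<Rightarrow> 'a hypergraph \<Rightarrow> 'a set \<times> 'a set set \<Rightarrow> bool" where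
  "infinite_tight_berge_path t H P \<longleftrightarrow>
     (\<exists>(v :: nat \<Rightarrow> 'a) (e :: nat \<Rightarrow> 'a set).
        inj v \<and> range v \<subseteq> fst H \<and> inj e \<and> range e \<subseteq> snd H \<and>
        (\<forall>i. v ` {i..i+t-1} \<subseteq> e i) \<and>
        P = (range v, range e))"

definition tight_berge_path ::
    "nat \<Rightarrow> 'a hypergraph \<Rightarrow> 'a set \<times> 'a set set \<Rightarrow> bool" where
  "tight_berge_path t H P \<longleftrightarrow>
     (\<exists>l. finite_tight_berge_path t H l P) \<or> infinite_tight_berge_path t H P"

definition core :: "'a set \<times> 'a set set \<Rightarrow> 'a set" where
  "core P = fst P"

definition monochromatic_path_in :: "('a set \<Rightarrow> 'c) \<Rightarrow> 'c \<Rightarrow> 'a set \<times> 'a set set \<Rightarrow> bool" where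
  "monochromatic_path_in \<phi> c P \<longleftrightarrow> (\<forall>f \<in> snd P. \<phi> f = c)"

definition monochromatic_path :: "('a set \<Rightarrow> 'c) \<Rightarrow> 'a set \<times> 'a set set \<Rightarrow> bool" where
  "monochromatic_path \<phi> P \<longleftrightarrow> (\<exists>c. monochromatic_path_in \<phi> c P)"

end

theory Submission
  imports Defs "HOL-Library.Countable_Set"
begin

text \<open>
  Put \<open>m = k - t + 1\<close> and label every vertex with a set of \<open>s\<close> colours. Since \<open>m * s < r\<close>, each edge
  can be given a colour lying in none of the labels of its \<open>m\<close> smallest vertices. Among any \<open>t\<close>
  core vertices in an edge, at least one is among these \<open>m\<close> smallest. Hence, on a path of colour
  \<open>c\<close>, a core vertex whose label contains \<open>c\<close> is within distance \<open>t\<close> along the path of a smaller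
  core vertex whose label does not. Label \<open>\<nat>\<close> in consecutive, rapidly growing blocks such that every
  \<open>s\<close>-set occurs as the label of some block. Given \<open>s\<close> paths, take a block labelled by all of their
  colours: each path covers at most \<open>2 * t + 1\<close> vertices of it per vertex preceding the block, which
  is too few.
\<close>

definition rank_in :: "'a::linorder set \<Rightarrow> 'a \<Rightarrow> nat" where
  "rank_in e x = card {y \<in> e. y < x}"

lemma rank_in_mono: "finite e \<Longrightarrow> x \<le> y \<Longrightarrow> rank_in e x \<le> rank_in e y"
  unfolding rank_in_def by (intro card_mono) auto

lemma rank_in_strict_mono:
  assumes "finite e" "x \<in> e" "x < y"
  shows "rank_in e x < rank_in e y"
  unfolding rank_in_def using assms by (intro psubset_card_mono) auto

lemma inj_on_rank_in: "finite e \<Longrightarrow> inj_on (rank_in e) e"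
  by (rule inj_onI) (metis linorder_neqE rank_in_strict_mono less_irrefl)

lemma rank_in_less_card: "finite e \<Longrightarrow> x \<in> e \<Longrightarrow> rank_in e x < card e"
  unfolding rank_in_def by (intro psubset_card_mono) auto

lemma card_rank_in_less:
  assumes "finite e"
  shows "card {x \<in> e. rank_in e x < m} \<le> m"
proof -
  have "card {x \<in> e. rank_in e x < m} \<le> card {..<m}"
    by (rule card_inj_on_le[where f = "rank_in e"])
      (auto intro: inj_on_subset[OF inj_on_rank_in[OF assms]])
  then show ?thesis by simp
qed

text \<open>Pigeonhole: ranks in \<open>e\<close> are distinct and below \<open>card e\<close>, so
  at most \<open>card e - m\<close> vertices have rank \<open>m\<close> or more. As this difference
  may truncate to 0, \<open>W\<close> has to be nonempty.\<close>

lemma ex_rank_in_less: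
  assumes "finite e" "W \<subseteq> e" "W \<noteq> {}" "card e < card W + m"
  shows "\<exists>x\<in>W. rank_in e x < m"
proof (rule ccontr)
  assume "\<not> ?thesis"
  then have "rank_in e ` W \<subseteq> {m..<card e}"
    using assms rank_in_less_card by fastforce
  then have "card W \<le> card {m..<card e}"
    by (intro card_inj_on_le[where f = "rank_in e"])
      (auto intro: inj_on_subset[OF inj_on_rank_in[OF assms(1)] assms(2)])
  moreover have "0 < card W"
    using assms finite_subset card_gt_0_iff by metis
  ultimately show False using assms(4) by auto
qed

definition avoids_labels :: "nat \<Rightarrow> ('a::linorder \<Rightarrow> 'c set) \<Rightarrow> 'a set \<Rightarrow> 'c \<Rightarrow> bool" where
  "avoids_labels m lab e c \<longleftrightarrow> (\<forall>x\<in>e. rank_in e x < m \<longrightarrow> c \<notin> lab x)"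

lemma ex_avoids_labels:
  assumes "finite e" and lab: "\<And>x. lab x \<subseteq> {..<r} \<and> card (lab x) \<le> s" and "s * m < r"
  shows "\<exists>c<r. avoids_labels m lab e c"
proof -
  let ?K = "{x \<in> e. rank_in e x < m}"
  have "card (\<Union>x\<in>?K. lab x) \<le> (\<Sum>x\<in>?K. card (lab x))"
    using assms(1) by (intro card_UN_le) auto
  also have "\<dots> \<le> card ?K * s"
    using lab sum_bounded_above[of ?K "\<lambda>x. card (lab x)" s] by simp
  also have "\<dots> \<le> m * s"
    using card_rank_in_less[OF assms(1)] by (rule mult_le_mono1)
  also have "\<dots> < card {..<r}"
    using assms(3) by (simp add: mult.commute)
  finally have "\<not> {..<r} \<subseteq> (\<Union>x\<in>?K. lab x)"
    using lab assms(1) by (metis (no_types, lifting) card_mono finite_UN_I finite_lessThan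
        finite_subset linorder_not_less mem_Collect_eq subsetI)
  then show ?thesis by (auto simp: avoids_labels_def)
qed

text \<open>\<open>I\<close> indexes the core vertices and \<open>J\<close> the edges, so that
  finite and infinite paths are treated together. Each core vertex in the block lies within
  \<open>t\<close> indices of a core vertex below \<open>a\<close>, and there are at most
  \<open>a\<close> of the latter.\<close>

lemma card_avoiding_path_block_le:
  fixes v :: "nat \<Rightarrow> nat" and e :: "nat \<Rightarrow> nat set"
  assumes inj: "inj_on v I"
    and windows: "\<And>i. i \<in> I \<Longrightarrow> \<exists>j\<in>J. i \<in> {j..j+t-1} \<and> {j..j+t-1} \<subseteq> I"
    and edges: "\<And>j. j \<in> J \<Longrightarrow> v ` {j..j+t-1} \<subseteq> e j \<and> e j \<in> nsets UNIV k \<and> avoids_labels m lab (e j) c"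
    and block: "\<And>x. x \<in> {a..<b} \<Longrightarrow> c \<in> lab x"
    and "k < t + m" "0 < t"
  shows "card (v ` I \<inter> {a..<b}) \<le> a * (2 * t + 1)"
proof -
  let ?S = "{i \<in> I. v i < a}"
  have inj_S: "inj_on v ?S" using inj by (rule inj_on_subset) auto
  have fin_S: "finite ?S"
    by (rule inj_on_finite[OF inj_S, of "{..<a}"]) auto
  have card_S: "card ?S \<le> a"
    using card_inj_on_le[OF inj_S, of "{..<a}"] by auto
  have sub: "v ` I \<inter> {a..<b} \<subseteq> v ` (\<Union>i\<in>?S. {i-t..i+t})"
  proof
    fix x assume "x \<in> v ` I \<inter> {a..<b}"
    then obtain i where i: "i \<in> I" "x = v i" "v i \<in> {a..<b}" by blast
    obtain j where j: "j \<in> J" "i \<in> {j..j+t-1}" "{j..j+t-1} \<subseteq> I"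
      using windows[OF i(1)] by blast
    note ej = edges[OF j(1)]
    have fin: "finite (e j)" and "card (e j) = k"
      using ej by (auto simp: nsets_def)
    moreover have "card (v ` {j..j+t-1}) = t"
      using inj_on_subset[OF inj j(3)] \<open>0 < t\<close> by (simp add: card_image)
    ultimately obtain i' where i': "i' \<in> {j..j+t-1}" "rank_in (e j) (v i') < m"
      using ex_rank_in_less[of "e j" "v ` {j..j+t-1}" m] ej j(2) \<open>k < t + m\<close> by auto
    have "v i' \<in> e j" using ej i'(1) by blast
    then have u: "c \<notin> lab (v i')"
      using ej i'(2) by (auto simp: avoids_labels_def)
    have "v i \<in> e j" using ej j(2) by blast
    then have "\<not> rank_in (e j) (v i) < m"
      using ej block[OF i(3)] by (auto simp: avoids_labels_def)
    then have "v i' < v i"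
      using i'(2) rank_in_mono[OF fin, of "v i" "v i'"] by force
    \<comment> \<open>All of \<open>{a..<b}\<close> has \<open>c\<close> in its label, and
      \<open>v i' < v i < b\<close>, so \<open>v i'\<close> can only lie before the block.\<close>
    then have "v i' < a"
      using u block[of "v i'"] i(3) by force
    moreover have "i \<in> {i'-t..i'+t}" using i'(1) j(2) by auto
    ultimately show "x \<in> v ` (\<Union>i\<in>?S. {i-t..i+t})"
      using i' j(3) i(2) by blast
  qed
  have "card (v ` I \<inter> {a..<b}) \<le> card (v ` (\<Union>i\<in>?S. {i-t..i+t}))"
    using sub fin_S by (intro card_mono) auto
  also have "\<dots> \<le> card (\<Union>i\<in>?S. {i-t..i+t})"
    using fin_S by (intro card_image_le) auto
  also have "\<dots> \<le> (\<Sum>i\<in>?S. card {i-t..i+t})"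
    using fin_S by (intro card_UN_le)
  \<comment> \<open>For \<open>i < t\<close> the truncated \<open>i - t\<close> only shortens the
    interval.\<close>
  also have "\<dots> \<le> card ?S * (2 * t + 1)"
    using sum_bounded_above[of ?S "\<lambda>i. card {i-t..i+t}" "2 * t + 1"] by simp
  also have "\<dots> \<le> a * (2 * t + 1)"
    using card_S by (rule mult_le_mono1)
  finally show ?thesis .
qed

lemma card_core_block_le:
  assumes path: "tight_berge_path t (complete_kgraph UNIV k) P"
    and mono: "monochromatic_path_in \<phi> c P"
    and avoid: "\<And>f. f \<in> nsets UNIV k \<Longrightarrow> avoids_labels m lab f (\<phi> f)"
    and block: "\<And>x. x \<in> {a..<b} \<Longrightarrow> c \<in> lab x"
    and "k < t + m" "0 < t" "0 < a"
  shows "card (core P \<inter> {a..<b}) \<le> a * (2 * t + 1)"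
proof -
  consider x where "core P = {x}"
    | l v e where "l \<noteq> 0" "inj_on v {1..l+t-1}" "e ` {1..l} \<subseteq> nsets UNIV k"
      "\<forall>i\<in>{1..l}. v ` {i..i+t-1} \<subseteq> e i" "P = (v ` {1..l+t-1}, e ` {1..l})"
    | v e where "inj v" "range e \<subseteq> nsets UNIV k" "\<forall>i. v ` {i..i+t-1} \<subseteq> e i" "P = (range v, range e)"
    using path
    unfolding tight_berge_path_def finite_tight_berge_path_def infinite_tight_berge_path_def
      complete_kgraph_def core_def
    by (auto split: if_splits)
  then show ?thesis
  proof cases
    case 1
    \<comment> \<open>A path of length 0 has no edges to argue with; its single vertex fits the
      bound because \<open>0 < a\<close>.\<close>
    have "card ({x} \<inter> {a..<b}) \<le> card {x}" by (rule card_mono) auto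
    with 1 \<open>0 < a\<close> show ?thesis by (simp add: Suc_leI trans_le_add1)
  next
    case 2
    have "card (v ` {1..l+t-1} \<inter> {a..<b}) \<le> a * (2 * t + 1)"
    proof (rule card_avoiding_path_block_le[where J = "{1..l}" and e = e and lab = lab and c = c])
      fix i assume "i \<in> {1..l+t-1}"
      then show "\<exists>j\<in>{1..l}. i \<in> {j..j+t-1} \<and> {j..j+t-1} \<subseteq> {1..l+t-1}"
        \<comment> \<open>Vertex \<open>i\<close> starts the window of edge \<open>i\<close>, except
          that the last \<open>t - 1\<close> vertices start none and lie in the window of edge
          \<open>l\<close>.\<close>
        using 2(1) \<open>0 < t\<close> by (intro bexI[of _ "min i l"]) auto
    next
      fix j assume "j \<in> {1..l}"
      moreover from this have "e j \<in> nsets UNIV k" using 2(3) by blast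
      ultimately show "v ` {j..j+t-1} \<subseteq> e j \<and> e j \<in> nsets UNIV k \<and> avoids_labels m lab (e j) c"
        using 2(4,5) mono avoid[of "e j"] by (auto simp: monochromatic_path_in_def)
    qed (use 2 assms in auto)
    with 2 show ?thesis by (simp add: core_def)
  next
    case 3
    have "card (range v \<inter> {a..<b}) \<le> a * (2 * t + 1)"
    proof (rule card_avoiding_path_block_le[where J = UNIV and e = e and lab = lab and c = c])
      fix i :: nat
      show "\<exists>j\<in>UNIV. i \<in> {j..j+t-1} \<and> {j..j+t-1} \<subseteq> UNIV"
        using \<open>0 < t\<close> by (intro bexI[of _ i]) auto
    next
      fix j
      have "e j \<in> nsets UNIV k" using 3(2) by blast
      then show "v ` {j..j+t-1} \<subseteq> e j \<and> e j \<in> nsets UNIV k \<and> avoids_labels m lab (e j) c"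
        using 3(3,4) mono avoid[of "e j"] by (auto simp: monochromatic_path_in_def)
    qed (use 3 assms in auto)
    with 3 show ?thesis by (simp add: core_def)
  qed
qed

lemma tight_berge_path_edges: "tight_berge_path t H P \<Longrightarrow> snd P \<subseteq> snd H"
  unfolding tight_berge_path_def finite_tight_berge_path_def infinite_tight_berge_path_def
  by (auto split: if_splits)

text \<open>A path of length 0 is monochromatic in every natural number, so the bound on the colour is a choice.\<close>
lemma monochromatic_path_colour_less:
  assumes "edge_colouring H r \<phi>" "tight_berge_path t H P" "monochromatic_path \<phi> P" "0 < r"
  shows "\<exists>c<r. monochromatic_path_in \<phi> c P"
proof (cases "snd P = {}")
  case True
  then show ?thesis using \<open>0 < r\<close> by (auto simp: monochromatic_path_in_def)
next
  case False
  then obtain f c where "f \<in> snd P" and c: "monochromatic_path_in \<phi> c P"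
    using assms(3) by (auto simp: monochromatic_path_def)
  then have "\<phi> f = c" "f \<in> snd H"
    using tight_berge_path_edges[OF assms(2)] by (auto simp: monochromatic_path_in_def)
  then have "c < r" using assms(1) by (auto simp: edge_colouring_def)
  with c show ?thesis by blast
qed

lemma ex_block_labelling:
  fixes M :: nat
  assumes "countable A" "A \<noteq> {}" "1 < M"
  shows "\<exists>lab :: nat \<Rightarrow> 'b. range lab \<subseteq> A \<and> (\<forall>S\<in>A. \<exists>n. \<forall>x\<in>{M^n..<M^Suc n}. lab x = S)"
proof -
  \<comment> \<open>The \<open>LEAST\<close> is the index of the block containing \<open>x\<close>;
    vertex 0, which precedes all blocks, gets the label of block 0.\<close>
  define lab where "lab x = from_nat_into A (LEAST n. x < M ^ Suc n)" for x
  have "\<exists>n. \<forall>x\<in>{M^n..<M^Suc n}. lab x = S" if S: "S \<in> A" for S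
  proof -
    obtain n where n: "from_nat_into A n = S"
      using from_nat_into_surj[OF assms(1) S] by blast
    have "(LEAST n'. x < M ^ Suc n') = n" if x: "x \<in> {M^n..<M^Suc n}" for x
    proof (rule Least_equality)
      fix n' assume "x < M ^ Suc n'"
      with x have "M ^ n < M ^ Suc n'" by auto
      then show "n \<le> n'" using \<open>1 < M\<close> by (simp only: power_strict_increasing_iff less_Suc_eq_le)
    qed (use x in auto)
    with n have "\<forall>x\<in>{M^n..<M^Suc n}. lab x = S" by (simp only: lab_def) blast
    then show ?thesis ..
  qed
  moreover have "range lab \<subseteq> A"
    using from_nat_into[OF assms(2)] by (auto simp: lab_def)
  ultimately show ?thesis by blast
qed

theorem theorem1p6:
  fixes s k t r :: nat
  assumes "k \<ge> t" and "t \<ge> 2" and "r = s * (k - t + 1) + 1"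
  shows "\<exists>\<phi>. edge_colouring (complete_kgraph (UNIV :: nat set) k) r \<phi> \<and>
           \<not> (\<exists>P :: nat \<Rightarrow> nat set \<times> nat set set.
                 (\<forall>i<s. tight_berge_path t (complete_kgraph UNIV k) (P i) \<and> monochromatic_path \<phi> (P i)) \<and>
                 (\<Union>i<s. core (P i)) = UNIV)"
proof -
  define m where "m = k - t + 1"
  \<comment> \<open>Block \<open>n\<close> then has \<open>M^n * (s * (2 * t + 1) + 1)\<close>
    vertices, \<open>M^n\<close> more than \<open>s\<close> paths can cover. The summand 2 also
    keeps \<open>1 < M\<close> when \<open>s = 0\<close>.\<close>
  define M where "M = s * (2 * t + 1) + 2"
  define A where "A = {S. S \<subseteq> {..<r} \<and> card S = s}"
  have "s * m < r" "k < t + m" "0 < t" "0 < r" "s \<le> r"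
    using assms by (auto simp: m_def)
  \<comment> \<open>Several paths may share a colour, so their set of colours may have to be padded
    to size \<open>s\<close> to become a label.\<close>
  have ex_superset: "\<exists>S\<in>A. C \<subseteq> S" if "C \<subseteq> {..<r}" "card C \<le> s" for C
    using exists_subset_between[of C s "{..<r}"] that \<open>s \<le> r\<close> by (auto simp: A_def)
  have "finite A" by (simp add: A_def)
  then have "countable A" "A \<noteq> {}" "1 < M"
    using ex_superset[of "{}"] by (auto simp: M_def intro: countable_finite)
  from ex_block_labelling[OF this] obtain lab where
    lab: "range lab \<subseteq> A" and blocks: "\<forall>S\<in>A. \<exists>n. \<forall>x\<in>{M^n..<M^Suc n}. lab x = S"
    by (elim exE conjE)
  have "lab x \<subseteq> {..<r} \<and> card (lab x) \<le> s" for x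
    using subsetD[OF lab rangeI[of lab x]] by (simp add: A_def)
  then have "\<exists>c<r. avoids_labels m lab f c" if "f \<in> nsets UNIV k" for f
    using that \<open>s * m < r\<close> by (intro ex_avoids_labels) (auto simp: nsets_def)
  then obtain \<phi> where \<phi>: "\<And>f. f \<in> nsets UNIV k \<Longrightarrow> \<phi> f < r \<and> avoids_labels m lab f (\<phi> f)"
    by metis
  have col: "edge_colouring (complete_kgraph UNIV k) r \<phi>"
    using \<phi> by (auto simp: edge_colouring_def complete_kgraph_def)
  have "(\<Union>i<s. core (P i)) \<noteq> UNIV"
    if P: "\<forall>i<s. tight_berge_path t (complete_kgraph UNIV k) (P i) \<and> monochromatic_path \<phi> (P i)" for P
  proof
    assume cover: "(\<Union>i<s. core (P i)) = UNIV"
    have "\<forall>i<s. \<exists>c<r. monochromatic_path_in \<phi> c (P i)"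
      using monochromatic_path_colour_less[OF col _ _ \<open>0 < r\<close>] P by blast
    then obtain c where c: "\<And>i. i < s \<Longrightarrow> c i < r \<and> monochromatic_path_in \<phi> (c i) (P i)"
      by metis
    have "c ` {..<s} \<subseteq> {..<r}" "card (c ` {..<s}) \<le> s"
      using c card_image_le[of "{..<s}" c] by auto
    from ex_superset[OF this] obtain S where S: "S \<in> A" "c ` {..<s} \<subseteq> S" ..
    \<comment> \<open>As \<open>S\<close> contains the colours of all the paths, this one block is
      hard to cover for each of them.\<close>
    obtain n where n: "\<forall>x\<in>{M^n..<M^Suc n}. lab x = S"
      using bspec[OF blocks S(1)] ..
    let ?B = "{M^n..<M^Suc n}"
    have pos: "0 < M ^ n" using \<open>1 < M\<close> by simp
    have bound: "card (core (P i) \<inter> ?B) \<le> M^n * (2 * t + 1)" if "i < s" for i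
    proof (rule card_core_block_le[OF _ _ _ _ \<open>k < t + m\<close> \<open>0 < t\<close> pos])
      show "tight_berge_path t (complete_kgraph UNIV k) (P i)" using P that by blast
      show "monochromatic_path_in \<phi> (c i) (P i)" using c[OF that] ..
      show "avoids_labels m lab f (\<phi> f)" if "f \<in> nsets UNIV k" for f using \<phi>[OF that] ..
      show "c i \<in> lab x" if "x \<in> ?B" for x
        using bspec[OF n that] S(2) \<open>i < s\<close> by blast
    qed
    have "?B = (\<Union>i<s. core (P i) \<inter> ?B)" using cover by blast
    then have "card ?B = card (\<Union>i<s. core (P i) \<inter> ?B)" by (rule arg_cong)
    also have "\<dots> \<le> (\<Sum>i<s. card (core (P i) \<inter> ?B))"
      by (rule card_UN_le) simp
    also have "\<dots> \<le> card {..<s} * (M^n * (2 * t + 1))"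
      using sum_bounded_above[of "{..<s}" "\<lambda>i. card (core (P i) \<inter> ?B)"] bound by force
    also have "\<dots> = M^n * (s * (2 * t + 1))"
      by (simp only: card_lessThan mult.left_commute)
    also have "\<dots> < M^n * (s * (2 * t + 1) + 1)"
      using pos by simp
    also have "\<dots> = card ?B"
      by (simp add: M_def algebra_simps)
    finally show False by simp
  qed
  with col show ?thesis by blast
qed

end
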